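(* Let $\Gamma$ be a countable set. Let $\{X_\gamma\}_{\gamma\in\Gamma}$ be a family of Banach spaces, each $X_\gamma$ equipped with a linear Hausdorff topology $\mathfrak{T}_\gamma$ coarser than the norm topology of $X_\gamma$, and let $\mathcal{E}$ be a Banach sequence space on $\Gamma$ equipped with a linear Hausdorff topology $\mathfrak{T}_{\mathcal{E}}$ coarser than the norm topology of $\mathcal{E}$. Suppose that (A1) the topology $\mathfrak{T}_{\mathcal{E}}$ is pre-Lebesgue; (A2) the space $(\bigoplus_{\gamma\in\Gamma}X_\gamma)_{\mathcal{E}}$ is equipped with a $\oplus$-compatible topology $\mathfrak{T}$; (A3) the mapping $\lfloor\bullet\rceil\colon(\bigoplus_{\gamma\in\Gamma}X_\gamma)_{\mathcal{E}}\to\mathcal{E}$, $\lfloor x\rceil=\sum_{\gamma\in\Gamma}\|x(\gamma)\|_{X_\gamma}\boldsymbol{e}_\gamma$, is $\mathfrak{T}$-to-$\mathfrak{T}_{\mathcal{E}}$ sequentially continuous when restricted to the unit sphere of $(\bigoplus_{\gamma\in\Gamma}X_\gamma)_{\mathcal{E}}$. Then $(\bigoplus_{\gamma\in\Gamma}X_\gamma)_{\mathcal{E}}$ has the property $\mathbf{H}(\mathfrak{T})$ provided every $X_\gamma$ has the property $\mathbf{H}(\mathfrak{T}_\gamma)$ and $\mathcal{E}$ has the property $\mathbf{H}(\mathfrak{T}_{\mathcal{E}})$.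
   Context: Conventions: unless stated otherwise, Banach spaces are real and infinite-dimensional. "Coarser" is meant in the non-strict sense. A linear topology is a vector space topology. Banach sequence space on a countable set $\Gamma$: a Banach space $X$ that is a linear subspace of the space $\omega(\Gamma)$ of all real functions on $\Gamma$, contains the characteristic functions of all finite subsets of $\Gamma$, and has the ideal property: if $|x(\gamma)|\le|y(\gamma)|$ for all $\gamma\in\Gamma$ and $y\in X$, then $x\in X$ and $\|x\|\le\|y\|$. $\boldsymbol{e}_\gamma$ is the $\gamma$-th unit vector. Pre-Lebesgue topology: a linear Hausdorff topology $\mathfrak{T}$ on a Banach sequence space $X$, coarser than the norm topology, is pre-Lebesgue if every pairwise disjoint, positive and order bounded sequence in $X$ converges to zero with respect to $\mathfrak{T}$. Direct sum: $(\bigoplus_{\gamma\in\Gamma}X_\gamma)_{\mathcal{E}}$ is the Banach space of all $x=\{x(\gamma)\}_{\gamma\in\Gamma}\in\prod_{\gamma}X_\gamma$ with $\sum_{\gamma}\|x(\gamma)\|_{X_\gamma}\boldsymbol{e}_\gamma\in\mathcal{E}$, with coordinate-wise operations and norm $\|x\|=\big\|\sum_{\gamma}\|x(\gamma)\|_{X_\gamma}\boldsymbol{e}_\gamma\big\|_{\mathcal{E}}$. Maps: $\pi_\gamma(x)=x(\gamma)$ is the projection of the direct sum onto $X_\gamma$; $j_\gamma\colon X_\gamma\to(\bigoplus X_\gamma)_{\mathcal{E}}$ places a vector in the $\gamma$-th coordinate and $0$ elsewhere; $j_{\mathcal{E}}\colon\mathcal{E}\to(\bigoplus X_\gamma)_{\mathcal{E}}$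 is $j_{\mathcal{E}}(a)=\{a(\gamma)x_\gamma\}_{\gamma\in\Gamma}$, where $\{x_\gamma\}_{\gamma\in\Gamma}$, $x_\gamma\in X_\gamma$, $\|x_\gamma\|=1$, is a sequence of norm-one vectors fixed once and for all. $\oplus$-compatible topology: a linear Hausdorff topology $\mathfrak{T}$ on $(\bigoplus X_\gamma)_{\mathcal{E}}$ is $\oplus$-compatible (with the $\mathfrak{T}_\gamma$ and $\mathfrak{T}_{\mathcal{E}}$) if (C1) $\mathfrak{T}$ is coarser than the norm topology; (C2) each $\pi_\gamma$ is $\mathfrak{T}$-to-$\mathfrak{T}_\gamma$ sequentially continuous; (C3) each $j_\gamma$ is $\mathfrak{T}_\gamma$-to-$\mathfrak{T}$ sequentially continuous; (C4) $j_{\mathcal{E}}$ is $\mathfrak{T}_{\mathcal{E}}$-to-$\mathfrak{T}$ sequentially continuous. Kadets--Klee property: for a linear Hausdorff topology $\mathfrak{T}$ on a Banach space $X$ coarser than the norm topology, $X$ has $\mathbf{H}(\mathfrak{T})$ if whenever $x_n,x$ lie on the unit sphere of $X$ and $x_n\to x$ in $\mathfrak{T}$, then $\|x_n-x\|\to0$. *)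

theory Defs
  imports "HOL-Analysis.Analysis" "HOL-Library.Function_Algebras"
begin

text \<open>Pointwise real vector space structure on functions; addition, subtraction and zero
  come from \<^theory>\<open>HOL-Library.Function_Algebras\<close>.\<close>

instantiation "fun" :: (type, real_vector) real_vector
begin

definition scaleR_fun :: "real \<Rightarrow> ('a \<Rightarrow> 'b) \<Rightarrow> 'a \<Rightarrow> 'b"
  where "scaleR_fun c f = (\<lambda>x. c *\<^sub>R f x)"

instance
  by standard
    (simp_all add: scaleR_fun_def plus_fun_def fun_eq_iff scaleR_add_right scaleR_add_left)

end

section \<open>Banach spaces and linear topologies on linear subspaces\<close>

text \<open>A normed space is a pair of a linear subspace \<open>V\<close> of an arbitrary real vector space and a
  function \<open>N\<close> that is a norm on \<open>V\<close>; its values outside \<open>V\<close> are irrelevant. Every family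
  of real vector spaces can be realised as a family of subspaces of one real vector space
  (its algebraic direct sum), so this is no restriction on a family of Banach spaces.\<close>

definition normed_space_on :: "'v::real_vector set \<Rightarrow> ('v \<Rightarrow> real) \<Rightarrow> bool"
  where "normed_space_on V N \<longleftrightarrow>
    subspace V \<and>
    (\<forall>x\<in>V. 0 \<le> N x) \<and>
    (\<forall>x\<in>V. N x = 0 \<longleftrightarrow> x = 0) \<and>
    (\<forall>x\<in>V. \<forall>c. N (c *\<^sub>R x) = \<bar>c\<bar> * N x) \<and>
    (\<forall>x\<in>V. \<forall>y\<in>V. N (x + y) \<le> N x + N y)"

text \<open>The locale \<^locale>\<open>Metric_space\<close> asks for nonnegativity and symmetry on the whole type,
  hence the case distinction.\<close>

definition norm_dist :: "'v::real_vector set \<Rightarrow> ('v \<Rightarrow> real) \<Rightarrow> 'v \<Rightarrow> 'v \<Rightarrow> real"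
  where "norm_dist V N x y = (if x \<in> V \<and> y \<in> V then N (x - y) else 0)"

lemma Metric_space_norm_dist:
  assumes "normed_space_on V N"
  shows "Metric_space V (norm_dist V N)"
proof
  have V: "subspace V"
    and N: "\<And>x. x \<in> V \<Longrightarrow> 0 \<le> N x" "\<And>x. x \<in> V \<Longrightarrow> N x = 0 \<longleftrightarrow> x = 0"
    "\<And>x c. x \<in> V \<Longrightarrow> N (c *\<^sub>R x) = \<bar>c\<bar> * N x"
    "\<And>x y. x \<in> V \<Longrightarrow> y \<in> V \<Longrightarrow> N (x + y) \<le> N x + N y"
    using assms by (auto simp: normed_space_on_def)
  show "0 \<le> norm_dist V N x y" for x y
    using V N(1) by (simp add: norm_dist_def subspace_diff)
  show "norm_dist V N x y = norm_dist V N y x" for x y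
    using N(3)[of "x - y" "-1"] V by (auto simp: norm_dist_def subspace_diff)
  show "norm_dist V N x y = 0 \<longleftrightarrow> x = y" if "x \<in> V" "y \<in> V" for x y
    using V N(2)[of "x - y"] that by (simp add: norm_dist_def subspace_diff)
  show "norm_dist V N x z \<le> norm_dist V N x y + norm_dist V N y z"
    if "x \<in> V" "y \<in> V" "z \<in> V" for x y z
    using V N(4)[of "x - y" "y - z"] that by (simp add: norm_dist_def subspace_diff)
qed

definition norm_topology :: "'v::real_vector set \<Rightarrow> ('v \<Rightarrow> real) \<Rightarrow> 'v topology"
  where "norm_topology V N = Metric_space.mtopology V (norm_dist V N)"

definition banach_space_on :: "'v::real_vector set \<Rightarrow> ('v \<Rightarrow> real) \<Rightarrow> bool"
  where "banach_space_on V N \<longleftrightarrow>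
    normed_space_on V N \<and> Metric_space.mcomplete V (norm_dist V N)"

definition infinite_dimensional :: "'v::real_vector set \<Rightarrow> bool"
  where "infinite_dimensional V \<longleftrightarrow> (\<nexists>B. finite B \<and> V \<subseteq> span B)"

definition unit_sphere_on :: "'v set \<Rightarrow> ('v \<Rightarrow> real) \<Rightarrow> 'v set"
  where "unit_sphere_on V N = {x \<in> V. N x = 1}"

definition linear_topology_on :: "'v::real_vector set \<Rightarrow> 'v topology \<Rightarrow> bool"
  where "linear_topology_on V T \<longleftrightarrow>
    topspace T = V \<and>
    continuous_map (prod_topology T T) T (\<lambda>(x, y). x + y) \<and>
    continuous_map (prod_topology euclideanreal T) T (\<lambda>(c, x). c *\<^sub>R x)"

text \<open>\<open>coarser_topology T T'\<close>: \<open>T\<close> is coarser than or equal to \<open>T'\<close>.\<close>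

definition coarser_topology :: "'v topology \<Rightarrow> 'v topology \<Rightarrow> bool"
  where "coarser_topology T T' \<longleftrightarrow>
    topspace T = topspace T' \<and> (\<forall>U. openin T U \<longrightarrow> openin T' U)"

definition coarser_linear_Hausdorff ::
    "'v::real_vector set \<Rightarrow> ('v \<Rightarrow> real) \<Rightarrow> 'v topology \<Rightarrow> bool"
  where "coarser_linear_Hausdorff V N T \<longleftrightarrow>
    linear_topology_on V T \<and> Hausdorff_space T \<and> coarser_topology T (norm_topology V N)"

definition seq_continuous_map :: "'a topology \<Rightarrow> 'b topology \<Rightarrow> ('a \<Rightarrow> 'b) \<Rightarrow> bool"
  where "seq_continuous_map T T' f \<longleftrightarrow>
    f \<in> topspace T \<rightarrow> topspace T' \<and>
    (\<forall>s x. (\<forall>n. s n \<in> topspace T) \<and> limitin T s x sequentially \<longrightarrow>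
      limitin T' (\<lambda>n. f (s n)) (f x) sequentially)"

definition kadets_klee :: "'v::real_vector set \<Rightarrow> ('v \<Rightarrow> real) \<Rightarrow> 'v topology \<Rightarrow> bool"
  where "kadets_klee V N T \<longleftrightarrow>
    (\<forall>s x. (\<forall>n. s n \<in> unit_sphere_on V N) \<and> x \<in> unit_sphere_on V N \<and>
      limitin T s x sequentially \<longrightarrow> (\<lambda>n. N (s n - x)) \<longlonglongrightarrow> 0)"

section \<open>Banach sequence spaces\<close>

definition banach_sequence_space :: "('g::countable \<Rightarrow> real) set \<Rightarrow> (('g \<Rightarrow> real) \<Rightarrow> real) \<Rightarrow> bool"
  where "banach_sequence_space E NE \<longleftrightarrow>
    banach_space_on E NE \<and>
    (\<forall>A. finite A \<longrightarrow> indicat_real A \<in> E) \<and>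
    (\<forall>x y. y \<in> E \<and> (\<forall>\<gamma>. \<bar>x \<gamma>\<bar> \<le> \<bar>y \<gamma>\<bar>) \<longrightarrow> x \<in> E \<and> NE x \<le> NE y)"

definition pre_Lebesgue ::
    "('g::countable \<Rightarrow> real) set \<Rightarrow> (('g \<Rightarrow> real) \<Rightarrow> real) \<Rightarrow> ('g \<Rightarrow> real) topology \<Rightarrow> bool"
  where "pre_Lebesgue E NE T \<longleftrightarrow>
    coarser_linear_Hausdorff E NE T \<and>
    (\<forall>s. (\<forall>n. s n \<in> E) \<and>
      (\<forall>m n. m \<noteq> n \<longrightarrow> (\<forall>\<gamma>. min \<bar>s m \<gamma>\<bar> \<bar>s n \<gamma>\<bar> = 0)) \<and>
      (\<forall>n \<gamma>. 0 \<le> s n \<gamma>) \<and>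
      (\<exists>a\<in>E. \<exists>b\<in>E. \<forall>n \<gamma>. a \<gamma> \<le> s n \<gamma> \<and> s n \<gamma> \<le> b \<gamma>) \<longrightarrow>
      limitin T s 0 sequentially)"

section \<open>Direct sums\<close>

text \<open>\<open>norm_fun N x\<close> is \<open>\<Sum>\<^sub>\<gamma> \<parallel>x \<gamma>\<parallel> e\<^sub>\<gamma>\<close>; the sum is a formal (coordinatewise) one and need not
  converge in the norm of \<open>E\<close>.\<close>

definition norm_fun :: "('g \<Rightarrow> 'v \<Rightarrow> real) \<Rightarrow> ('g \<Rightarrow> 'v) \<Rightarrow> 'g \<Rightarrow> real"
  where "norm_fun N x = (\<lambda>\<gamma>. N \<gamma> (x \<gamma>))"

definition direct_sum ::
    "('g \<Rightarrow> 'v set) \<Rightarrow> ('g \<Rightarrow> 'v \<Rightarrow> real) \<Rightarrow> ('g \<Rightarrow> real) set \<Rightarrow> ('g \<Rightarrow> 'v) set"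
  where "direct_sum X N E = {x. (\<forall>\<gamma>. x \<gamma> \<in> X \<gamma>) \<and> norm_fun N x \<in> E}"

definition direct_sum_norm ::
    "('g \<Rightarrow> 'v \<Rightarrow> real) \<Rightarrow> (('g \<Rightarrow> real) \<Rightarrow> real) \<Rightarrow> ('g \<Rightarrow> 'v) \<Rightarrow> real"
  where "direct_sum_norm N NE x = NE (norm_fun N x)"

lemma normed_space_on_direct_sum:
  fixes X :: "'g::countable \<Rightarrow> 'v::real_vector set"
  assumes X: "\<And>\<gamma>. normed_space_on (X \<gamma>) (N \<gamma>)" and E: "banach_sequence_space E NE"
  shows "normed_space_on (direct_sum X N E) (direct_sum_norm N NE)"
proof -
  have sX: "\<And>\<gamma>. subspace (X \<gamma>)" and N: "\<And>\<gamma> x. x \<in> X \<gamma> \<Longrightarrow> 0 \<le> N \<gamma> x"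
    "\<And>\<gamma> x. x \<in> X \<gamma> \<Longrightarrow> N \<gamma> x = 0 \<longleftrightarrow> x = 0"
    "\<And>\<gamma> x c. x \<in> X \<gamma> \<Longrightarrow> N \<gamma> (c *\<^sub>R x) = \<bar>c\<bar> * N \<gamma> x"
    "\<And>\<gamma> x y. x \<in> X \<gamma> \<Longrightarrow> y \<in> X \<gamma> \<Longrightarrow> N \<gamma> (x + y) \<le> N \<gamma> x + N \<gamma> y"
    using X by (auto simp: normed_space_on_def)
  have sE: "subspace E" and NE: "\<And>x. x \<in> E \<Longrightarrow> 0 \<le> NE x"
    "\<And>x. x \<in> E \<Longrightarrow> NE x = 0 \<longleftrightarrow> x = 0"
    "\<And>x c. x \<in> E \<Longrightarrow> NE (c *\<^sub>R x) = \<bar>c\<bar> * NE x"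
    "\<And>x y. x \<in> E \<Longrightarrow> y \<in> E \<Longrightarrow> NE (x + y) \<le> NE x + NE y"
    using E by (auto simp: banach_sequence_space_def banach_space_on_def normed_space_on_def)
  have ideal: "x \<in> E \<and> NE x \<le> NE y" if "y \<in> E" "\<And>\<gamma>. \<bar>x \<gamma>\<bar> \<le> \<bar>y \<gamma>\<bar>" for x y
    using E that unfolding banach_sequence_space_def by blast
  have scale: "norm_fun N (c *\<^sub>R x) = \<bar>c\<bar> *\<^sub>R norm_fun N x" if "x \<in> direct_sum X N E" for c x
    using that N(3) by (simp add: direct_sum_def norm_fun_def scaleR_fun_def)
  have add: "norm_fun N (x + y) \<in> E \<and> NE (norm_fun N (x + y)) \<le> NE (norm_fun N x + norm_fun N y)"
    if "x \<in> direct_sum X N E" "y \<in> direct_sum X N E" for x y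
  proof (rule ideal)
    show "norm_fun N x + norm_fun N y \<in> E"
      using that sE by (simp add: direct_sum_def subspace_add)
    show "\<bar>norm_fun N (x + y) \<gamma>\<bar> \<le> \<bar>(norm_fun N x + norm_fun N y) \<gamma>\<bar>" for \<gamma>
    proof -
      have "x \<gamma> \<in> X \<gamma>" "y \<gamma> \<in> X \<gamma>" "x \<gamma> + y \<gamma> \<in> X \<gamma>"
        using that sX by (auto simp: direct_sum_def subspace_add)
      then have "N \<gamma> (x \<gamma> + y \<gamma>) \<le> N \<gamma> (x \<gamma>) + N \<gamma> (y \<gamma>)" "0 \<le> N \<gamma> (x \<gamma> + y \<gamma>)"
        using N(1,4) by blast+
      then show ?thesis
        by (simp add: norm_fun_def)
    qed
  qed
  have N0: "N \<gamma> 0 = 0" for \<gamma>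
    using N(2) sX subspace_0 by blast
  have sub: "subspace (direct_sum X N E)"
  proof (rule subspaceI)
    show "0 \<in> direct_sum X N E"
      using sX sE N0 subspace_0[OF sE]
      by (simp add: direct_sum_def norm_fun_def subspace_0 zero_fun_def)
    show "x + y \<in> direct_sum X N E" if "x \<in> direct_sum X N E" "y \<in> direct_sum X N E" for x y
      using add[OF that] that sX by (simp add: direct_sum_def subspace_add)
    show "c *\<^sub>R x \<in> direct_sum X N E" if "x \<in> direct_sum X N E" for c x
    proof -
      have "norm_fun N (c *\<^sub>R x) \<in> E"
        using scale[OF that] that sE by (simp add: direct_sum_def subspace_scale)
      then show ?thesis
        using that sX by (simp add: direct_sum_def scaleR_fun_def subspace_scale)
    qed
  qed
  have "norm_fun N x = 0 \<longleftrightarrow> x = 0" if "x \<in> direct_sum X N E" for x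
    using that N(2) by (auto simp: direct_sum_def norm_fun_def fun_eq_iff)
  moreover have "NE (norm_fun N (x + y)) \<le> NE (norm_fun N x) + NE (norm_fun N y)"
    if "x \<in> direct_sum X N E" "y \<in> direct_sum X N E" for x y
    using add[OF that] NE(4)[of "norm_fun N x" "norm_fun N y"] that by (simp add: direct_sum_def)
  moreover have "norm_fun N x \<in> E" if "x \<in> direct_sum X N E" for x
    using that by (simp add: direct_sum_def)
  ultimately show ?thesis
    unfolding normed_space_on_def direct_sum_norm_def
    using sub NE(1-3) scale by simp
qed

definition coord_inj :: "'g \<Rightarrow> 'v::real_vector \<Rightarrow> 'g \<Rightarrow> 'v"
  where "coord_inj \<gamma> v = (\<lambda>\<delta>. if \<delta> = \<gamma> then v else 0)"

definition seq_inj :: "('g \<Rightarrow> 'v::real_vector) \<Rightarrow> ('g \<Rightarrow> real) \<Rightarrow> 'g \<Rightarrow> 'v"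
  where "seq_inj u a = (\<lambda>\<gamma>. a \<gamma> *\<^sub>R u \<gamma>)"

text \<open>\<open>u\<close> is the fixed family of norm-one vectors \<open>u \<gamma> \<in> X \<gamma>\<close>.\<close>

definition oplus_compatible ::
    "('g::countable \<Rightarrow> 'v::real_vector set) \<Rightarrow> ('g \<Rightarrow> 'v \<Rightarrow> real) \<Rightarrow> ('g \<Rightarrow> 'v topology) \<Rightarrow>
     ('g \<Rightarrow> real) set \<Rightarrow> (('g \<Rightarrow> real) \<Rightarrow> real) \<Rightarrow> ('g \<Rightarrow> real) topology \<Rightarrow>
     ('g \<Rightarrow> 'v) \<Rightarrow> ('g \<Rightarrow> 'v) topology \<Rightarrow> bool"
  where "oplus_compatible X N TX E NE TE u T \<longleftrightarrow>
    coarser_linear_Hausdorff (direct_sum X N E) (direct_sum_norm N NE) T \<and>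
    (\<forall>\<gamma>. seq_continuous_map T (TX \<gamma>) (\<lambda>x. x \<gamma>)) \<and>
    (\<forall>\<gamma>. seq_continuous_map (TX \<gamma>) T (coord_inj \<gamma>)) \<and>
    seq_continuous_map TE T (seq_inj u)"

end

theory Submission
  imports Defs
begin

text \<open>Let \<open>s n\<close> converge to \<open>x\<close> in the topology of the direct sum, all of norm one, and write
  \<open>\<lfloor>x\<rfloor>\<close> for the sequence \<open>norm_fun N x\<close> of coordinate norms. As
  this map is sequentially continuous on the unit sphere, \<open>\<lfloor>s n\<rfloor>\<close> converges to \<open>\<lfloor>x\<rfloor>\<close> in the
  topology of \<open>E\<close>; these are vectors of norm one, so the Kadets--Klee property of \<open>E\<close> makes
  the convergence a norm convergence. In
  particular the norm of each coordinate of \<open>s n\<close> converges to that of \<open>x\<close>, and the Kadets--Klee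
  properties of the summands, freed from the unit sphere by rescaling
  (\<open>kadets_klee_norm_convergent\<close>), give norm convergence in every coordinate.

  To pass from the coordinates to the whole direct sum one needs the tails of \<open>\<lfloor>x\<rfloor>\<close> to be small
  in norm (\<open>direct_sum_norm_tendsto_0\<close>). This is where the pre-Lebesgue property enters: a
  Banach sequence space with the Kadets--Klee property for a pre-Lebesgue topology is order
  continuous (\<open>pre_Lebesgue_kadets_klee_tail_small\<close>). Otherwise, by completeness,
  some positive \<open>b\<close> would have disjoint pieces with norms bounded away from \<open>0\<close>. These pieces
  converge to \<open>0\<close> in the topology of \<open>E\<close>, so to contradict the Kadets--Klee property it suffices
  to find a vector whose norm is asymptotically unchanged when single pieces from some
  sequence of distinct ones are added to it. Labelling the
  pieces by rationals, the sums of all pieces with label below a real number \<open>t\<close> have norms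
  increasing in \<open>t\<close>, and the sum for a point of continuity \<open>t\<close> is such a vector
  (\<open>pre_Lebesgue_kadets_klee_disjoint_small\<close>).\<close>

section \<open>Normed subspaces and linear topologies\<close>

lemma normed_space_onD:
  assumes "normed_space_on V N"
  shows "subspace V"
    and "x \<in> V \<Longrightarrow> 0 \<le> N x"
    and "x \<in> V \<Longrightarrow> N x = 0 \<longleftrightarrow> x = 0"
    and "x \<in> V \<Longrightarrow> N (c *\<^sub>R x) = \<bar>c\<bar> * N x"
    and "x \<in> V \<Longrightarrow> y \<in> V \<Longrightarrow> N (x + y) \<le> N x + N y"
    and "N 0 = 0"
  using assms subspace_0 by (auto simp: normed_space_on_def)

lemma norm_minus_commute_on:
  assumes "normed_space_on V N" "x \<in> V" "y \<in> V"
  shows "N (x - y) = N (y - x)"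
  using normed_space_onD(4)[OF assms(1), of "x - y" "-1"] normed_space_onD(1)[OF assms(1)] assms(2,3)
  by (simp add: subspace_diff)

lemma limitin_scaleR:
  assumes T: "linear_topology_on V T" and s: "limitin T s x F" and c: "(c \<longlongrightarrow> d) F"
  shows "limitin T (\<lambda>n. c n *\<^sub>R s n) (d *\<^sub>R x) F"
proof -
  have "limitin (prod_topology euclideanreal T) (\<lambda>n. (c n, s n)) (d, x) F"
    using s c by (simp add: limitin_pairwise o_def)
  moreover have "continuous_map (prod_topology euclideanreal T) T (\<lambda>(c, x). c *\<^sub>R x)"
    using T by (simp add: linear_topology_on_def)
  ultimately show ?thesis
    using continuous_map_limit by (fastforce simp: o_def)
qed

lemma limitin_add:
  assumes T: "linear_topology_on V T" and s: "limitin T s x F" and r: "limitin T r y F"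
  shows "limitin T (\<lambda>n. s n + r n) (x + y) F"
proof -
  have "limitin (prod_topology T T) (\<lambda>n. (s n, r n)) (x, y) F"
    using s r by (simp add: limitin_pairwise o_def)
  moreover have "continuous_map (prod_topology T T) T (\<lambda>(x, y). x + y)"
    using T by (simp add: linear_topology_on_def)
  ultimately show ?thesis
    using continuous_map_limit by (fastforce simp: o_def)
qed

lemma seq_continuous_mapD:
  assumes "seq_continuous_map T T' f" "\<And>n. s n \<in> topspace T" "limitin T s x sequentially"
  shows "limitin T' (\<lambda>n. f (s n)) (f x) sequentially"
  using assms(1)[unfolded seq_continuous_map_def, THEN conjunct2, rule_format, of s x] assms(2,3)
  by blast

text \<open>The Kadets--Klee property is stated on the unit sphere only. As scalar multiplication is
  jointly continuous for the topology, normalising the vectors frees it of the sphere: it is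
  enough that the norms converge to the norm of the limit.\<close>

lemma kadets_klee_norm_convergent:
  assumes V: "normed_space_on V N" and T: "linear_topology_on V T" and H: "kadets_klee V N T"
    and s: "\<And>n. s n \<in> V" and x: "x \<in> V" and lim: "limitin T s x sequentially"
    and norms: "(\<lambda>n. N (s n)) \<longlonglongrightarrow> N x"
  shows "(\<lambda>n. N (s n - x)) \<longlonglongrightarrow> 0"
proof (cases "x = 0")
  case True
  then show ?thesis
    using norms normed_space_onD(6)[OF V] by simp
next
  case False
  note sub = normed_space_onD(1)[OF V]
  define a where "a = N x"
  have a: "a > 0"
    using False x normed_space_onD(2,3)[OF V, of x] by (simp add: a_def)
  \<comment> \<open>A vanishing \<open>s n\<close> cannot be normalised; any vector of the sphere serves in its place,
    since this happens finitely often.\<close>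
  define y where "y n = (if s n = 0 then inverse a *\<^sub>R x else inverse (N (s n)) *\<^sub>R s n)" for n
  have pos: "N (s n) > 0" if "s n \<noteq> 0" for n
    using that s[of n] normed_space_onD(2,3)[OF V, of "s n"] by simp
  have y_sphere: "y n \<in> unit_sphere_on V N" for n
    using a pos[of n] s[of n] x normed_space_onD(4)[OF V] sub
    by (auto simp: y_def unit_sphere_on_def subspace_scale a_def)
  have x_sphere: "inverse a *\<^sub>R x \<in> unit_sphere_on V N"
    using a x normed_space_onD(4)[OF V] sub by (auto simp: unit_sphere_on_def subspace_scale a_def)
  have "eventually (\<lambda>n. N (s n) > 0) sequentially"
    using order_tendstoD(1)[OF norms] a by (simp add: a_def)
  then have "eventually (\<lambda>n. inverse (N (s n)) *\<^sub>R s n = y n) sequentially"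
    by eventually_elim (use normed_space_onD(6)[OF V] in \<open>auto simp: y_def\<close>)
  moreover have "limitin T (\<lambda>n. inverse (N (s n)) *\<^sub>R s n) (inverse a *\<^sub>R x) sequentially"
    using a norms by (intro limitin_scaleR[OF T lim] tendsto_inverse) (simp_all add: a_def)
  ultimately have "limitin T y (inverse a *\<^sub>R x) sequentially"
    by (rule limitin_transform_eventually)
  then have y_lim: "(\<lambda>n. N (y n - inverse a *\<^sub>R x)) \<longlonglongrightarrow> 0"
    using H y_sphere x_sphere unfolding kadets_klee_def by blast
  have bound: "N (s n - x) \<le> N (s n) * N (y n - inverse a *\<^sub>R x) + \<bar>N (s n) / a - 1\<bar> * a" for n
  proof -
    have eq: "s n - x = N (s n) *\<^sub>R (y n - inverse a *\<^sub>R x) + (N (s n) / a - 1) *\<^sub>R x"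
      using pos[of n] normed_space_onD(6)[OF V]
      by (auto simp: y_def algebra_simps divide_inverse)
    have d: "y n - inverse a *\<^sub>R x \<in> V"
      using y_sphere[of n] x sub by (simp add: unit_sphere_on_def subspace_diff subspace_scale)
    have "N (s n - x) \<le> N (N (s n) *\<^sub>R (y n - inverse a *\<^sub>R x)) + N ((N (s n) / a - 1) *\<^sub>R x)"
      unfolding eq using d x sub by (intro normed_space_onD(5)[OF V] subspace_scale)
    also have "\<dots> = N (s n) * N (y n - inverse a *\<^sub>R x) + \<bar>N (s n) / a - 1\<bar> * a"
      using normed_space_onD(4)[OF V d] normed_space_onD(4)[OF V x] normed_space_onD(2)[OF V s[of n]]
      by (simp add: a_def)
    finally show ?thesis .
  qed
  have "(\<lambda>n. N (s n) * N (y n - inverse a *\<^sub>R x) + \<bar>N (s n) / a - 1\<bar> * a)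
      \<longlonglongrightarrow> a * 0 + \<bar>a / a - 1\<bar> * a"
    using a by (intro tendsto_intros norms[folded a_def] y_lim) simp
  then have "(\<lambda>n. N (s n) * N (y n - inverse a *\<^sub>R x) + \<bar>N (s n) / a - 1\<bar> * a) \<longlonglongrightarrow> 0"
    using a by simp
  then show ?thesis
    by (rule Lim_null_comparison[rotated])
      (use bound s x sub normed_space_onD(2)[OF V] in \<open>auto simp: subspace_diff\<close>)
qed

section \<open>Banach sequence spaces\<close>

lemma banach_sequence_spaceD:
  assumes "banach_sequence_space E NE"
  shows "normed_space_on E NE"
    and "Metric_space.mcomplete E (norm_dist E NE)"
    and "finite A \<Longrightarrow> indicat_real A \<in> E"
    and "y \<in> E \<Longrightarrow> (\<And>\<gamma>. \<bar>x \<gamma>\<bar> \<le> \<bar>y \<gamma>\<bar>) \<Longrightarrow> x \<in> E"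
    and "y \<in> E \<Longrightarrow> (\<And>\<gamma>. \<bar>x \<gamma>\<bar> \<le> \<bar>y \<gamma>\<bar>) \<Longrightarrow> NE x \<le> NE y"
  using assms unfolding banach_sequence_space_def banach_space_on_def by blast+

lemma
  assumes E: "banach_sequence_space E NE" and b: "b \<in> E"
  shows restriction_in: "indicat_real A * b \<in> E"
    and norm_restriction_mono: "A \<subseteq> B \<Longrightarrow> NE (indicat_real A * b) \<le> NE (indicat_real B * b)"
proof -
  show "indicat_real A * b \<in> E" for A
    by (rule banach_sequence_spaceD(4)[OF E b]) (simp add: indicator_def)
  then show "NE (indicat_real A * b) \<le> NE (indicat_real B * b)" if "A \<subseteq> B"
    using that by (intro banach_sequence_spaceD(5)[OF E]) (auto simp: indicator_def)
qed

lemma norm_unit_vector_pos: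
  assumes E: "banach_sequence_space E NE"
  shows "0 < NE (indicat_real {\<gamma>})"
proof -
  have "indicat_real {\<gamma>} \<in> E" "indicat_real {\<gamma>} \<noteq> 0"
    using banach_sequence_spaceD(3)[OF E] by (auto simp: fun_eq_iff indicator_def)
  then show ?thesis
    using normed_space_onD(2,3)[OF banach_sequence_spaceD(1)[OF E], of "indicat_real {\<gamma>}"] by simp
qed

lemma abs_coordinate_le_norm:
  assumes E: "banach_sequence_space E NE" and a: "a \<in> E"
  shows "\<bar>a \<gamma>\<bar> * NE (indicat_real {\<gamma>}) \<le> NE a"
proof -
  have "\<bar>a \<gamma>\<bar> * NE (indicat_real {\<gamma>}) = NE (a \<gamma> *\<^sub>R indicat_real {\<gamma>})"
    using normed_space_onD(4)[OF banach_sequence_spaceD(1)[OF E]] banach_sequence_spaceD(3)[OF E]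
    by simp
  also have "\<dots> \<le> NE a"
    by (rule banach_sequence_spaceD(5)[OF E a]) (simp add: scaleR_fun_def indicator_def)
  finally show ?thesis .
qed

lemma coordinate_tendsto:
  assumes E: "banach_sequence_space E NE" and s: "\<And>n. s n \<in> E" "a \<in> E"
    and lim: "(\<lambda>n. NE (s n - a)) \<longlonglongrightarrow> 0"
  shows "(\<lambda>n. s n \<gamma>) \<longlonglongrightarrow> a \<gamma>"
proof -
  have "\<bar>s n \<gamma> - a \<gamma>\<bar> \<le> NE (s n - a) / NE (indicat_real {\<gamma>})" for n
    using abs_coordinate_le_norm[OF E, of "s n - a" \<gamma>] norm_unit_vector_pos[OF E, of \<gamma>] s
      normed_space_onD(1)[OF banach_sequence_spaceD(1)[OF E]]
    by (simp add: subspace_diff pos_le_divide_eq)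
  then have "eventually (\<lambda>n. norm (s n \<gamma> - a \<gamma>) \<le> NE (s n - a) / NE (indicat_real {\<gamma>})) sequentially"
    by simp
  moreover have "(\<lambda>n. NE (s n - a) / NE (indicat_real {\<gamma>})) \<longlonglongrightarrow> 0"
    using tendsto_divide[OF lim tendsto_const] norm_unit_vector_pos[OF E, of \<gamma>] by auto
  ultimately have "(\<lambda>n. s n \<gamma> - a \<gamma>) \<longlonglongrightarrow> 0"
    by (rule Lim_null_comparison)
  then show ?thesis
    by (simp add: LIM_zero_iff)
qed

lemma norm_finite_support_le:
  assumes E: "banach_sequence_space E NE" and F: "finite F"
  shows "NE (indicat_real F * a) \<le> (\<Sum>\<gamma>\<in>F. \<bar>a \<gamma>\<bar> * NE (indicat_real {\<gamma>}))
    \<and> indicat_real F * a \<in> E"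
  using F
proof (induction F rule: finite_induct)
  case empty
  then show ?case
    using normed_space_onD(1,6)[OF banach_sequence_spaceD(1)[OF E]]
    by (simp add: times_fun_def zero_fun_def[symmetric] subspace_0)
next
  case (insert \<gamma> F)
  note V = banach_sequence_spaceD(1)[OF E]
  have e: "indicat_real {\<gamma>} \<in> E"
    using banach_sequence_spaceD(3)[OF E] by simp
  have eq: "indicat_real (insert \<gamma> F) * a = a \<gamma> *\<^sub>R indicat_real {\<gamma>} + indicat_real F * a"
    using insert(2) by (auto simp: fun_eq_iff scaleR_fun_def indicator_def)
  have e': "a \<gamma> *\<^sub>R indicat_real {\<gamma>} \<in> E"
    using e normed_space_onD(1)[OF V] by (simp add: subspace_scale)
  show ?case
    unfolding eq
  proof
    have "NE (a \<gamma> *\<^sub>R indicat_real {\<gamma>} + indicat_real F * a)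
        \<le> NE (a \<gamma> *\<^sub>R indicat_real {\<gamma>}) + NE (indicat_real F * a)"
      using insert.IH by (intro normed_space_onD(5)[OF V e']) blast
    then show "NE (a \<gamma> *\<^sub>R indicat_real {\<gamma>} + indicat_real F * a)
        \<le> (\<Sum>\<gamma>\<in>insert \<gamma> F. \<bar>a \<gamma>\<bar> * NE (indicat_real {\<gamma>}))"
      unfolding normed_space_onD(4)[OF V e] sum.insert[OF insert.hyps] using insert.IH by linarith
    show "a \<gamma> *\<^sub>R indicat_real {\<gamma>} + indicat_real F * a \<in> E"
      using insert.IH by (intro subspace_add[OF normed_space_onD(1)[OF V] e']) blast
  qed
qed

section \<open>Order continuity from the Kadets--Klee property\<close>

text \<open>Label the disjoint sets by rationals and let \<open>U t\<close> be the union of those with label below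
  \<open>t\<close>. The norm of \<open>b\<close> restricted to \<open>U t\<close> increases with the real number \<open>t\<close>, hence is
  continuous at some \<open>t\<close>. For labels \<open>q\<^sub>j\<close> decreasing to this \<open>t\<close>, adding the piece of label
  \<open>q\<^sub>j\<close> to the restriction to \<open>U t\<close> changes the norm by an amount tending to \<open>0\<close>, and the pieces
  converge to \<open>0\<close> because the topology is pre-Lebesgue. By the Kadets--Klee property the pieces
  converge to \<open>0\<close> in norm.\<close>

lemma pre_Lebesgue_kadets_klee_disjoint_small:
  fixes S :: "nat \<Rightarrow> 'g::countable set"
  assumes E: "banach_sequence_space E NE" and L: "pre_Lebesgue E NE T" and H: "kadets_klee E NE T"
    and b: "b \<in> E" "\<And>\<gamma>. 0 \<le> b \<gamma>" and S: "disjoint_family S" and \<epsilon>: "0 < \<epsilon>"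
  shows "\<exists>n. NE (indicat_real (S n) * b) < \<epsilon>"
proof -
  note V = banach_sequence_spaceD(1)[OF E]
  have T: "linear_topology_on E T"
    using L by (simp add: pre_Lebesgue_def coarser_linear_Hausdorff_def)
  define P where "P q = S (to_nat q)" for q :: rat
  have P: "P q \<inter> P r = {}" if "q \<noteq> r" for q r
    using S that unfolding P_def disjoint_family_on_def by simp
  define U where "U t = (\<Union>q\<in>{q. of_rat q < t}. P q)" for t :: real
  define f where "f t = NE (indicat_real (U t) * b)" for t
  have "mono f"
    unfolding f_def U_def
    by (intro monoI norm_restriction_mono[OF E b(1)]) (force intro: less_le_trans)
  then obtain t where t: "isCont f t"
    using mono_ctble_discont[of f] uncountable_UNIV_real by fastforce
  \<comment> \<open>The brackets are pairwise disjoint, which makes the labels distinct.\<close>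
  obtain q :: "nat \<Rightarrow> rat" where q: "t + 1 / (real j + 2) < of_rat (q j)"
      "of_rat (q j) < t + 1 / (real j + 1)" for j
  proof -
    have "\<exists>r. t + 1 / (real j + 2) < of_rat r \<and> of_rat r < t + 1 / (real j + 1)" for j :: nat
      by (intro of_rat_dense) (simp add: field_simps)
    then show ?thesis
      using that by metis
  qed
  have q_less: "q k < q j" if "j < k" for j k
  proof -
    have "1 / (real k + 1) \<le> 1 / (real j + 2)"
      using that by (intro divide_left_mono) auto
    then have "(of_rat (q k) :: real) < of_rat (q j)"
      using q(2)[of k] q(1)[of j] by linarith
    then show ?thesis
      by (simp add: of_rat_less)
  qed
  have q_t: "t < of_rat (q j)" for j
    using q(1)[of j] by (smt (verit) divide_pos_pos of_nat_0_le_iff)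
  let ?w = "\<lambda>j. indicat_real (P (q j)) * b"
  have w_E: "?w j \<in> E" for j
    by (rule restriction_in[OF E b(1)])
  have "limitin T ?w 0 sequentially"
  proof -
    have "min \<bar>?w j \<gamma>\<bar> \<bar>?w k \<gamma>\<bar> = 0" if "j \<noteq> k" for j k \<gamma>
    proof -
      have "q j \<noteq> q k"
        using that q_less by (metis less_irrefl linorder_neqE_nat)
      then show ?thesis
        using P[of "q j" "q k"] by (auto simp: indicator_def)
    qed
    moreover have "\<exists>a\<in>E. \<exists>c\<in>E. \<forall>n \<gamma>. a \<gamma> \<le> ?w n \<gamma> \<and> ?w n \<gamma> \<le> c \<gamma>"
      using b subspace_0[OF normed_space_onD(1)[OF V]]
      by (intro bexI[of _ 0] bexI[of _ b]) (auto simp: indicator_def)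
    ultimately show ?thesis
      using L w_E b(2) unfolding pre_Lebesgue_def by (simp add: indicator_def)
  qed
  moreover have U_E: "indicat_real (U t) * b \<in> E"
    by (rule restriction_in[OF E b(1)])
  then have "limitin T (\<lambda>j. indicat_real (U t) * b) (indicat_real (U t) * b) sequentially"
    using T by (simp add: limitin_const_iff linear_topology_on_def)
  ultimately have lim:
    "limitin T (\<lambda>j. indicat_real (U t) * b + ?w j) (indicat_real (U t) * b) sequentially"
    using limitin_add[OF T] by fastforce
  have sum_eq: "indicat_real (U t) * b + ?w j = indicat_real (U t \<union> P (q j)) * b" for j
  proof -
    have "U t \<inter> P (q j) = {}"
    proof -
      have "r \<noteq> q j" if "of_rat r < t" for r
        using q_t[of j] that by auto
      then show ?thesis
        using P unfolding U_def by blast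
    qed
    then show ?thesis
      by (auto simp: fun_eq_iff indicator_def)
  qed
  have "(\<lambda>j. NE (indicat_real (U t) * b + ?w j)) \<longlonglongrightarrow> f t"
  proof (rule real_tendsto_sandwich)
    show "eventually (\<lambda>j. f t \<le> NE (indicat_real (U t) * b + ?w j)) sequentially"
      unfolding f_def sum_eq by (intro always_eventually allI norm_restriction_mono[OF E b(1)]) auto
    have "U t \<union> P (q j) \<subseteq> U (t + 1 / (real j + 1))" for j
    proof -
      have "of_rat r < t + 1 / (real j + 1)" if "of_rat r < t" for r
        using that q(2)[of j] q_t[of j] by linarith
      then show ?thesis
        using q(2)[of j] unfolding U_def by blast
    qed
    then show "eventually (\<lambda>j. NE (indicat_real (U t) * b + ?w j) \<le> f (t + 1 / (real j + 1))) sequentially"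
      unfolding f_def sum_eq by (intro always_eventually allI norm_restriction_mono[OF E b(1)])
    have "(\<lambda>j. t + 1 / (real j + 1)) \<longlonglongrightarrow> t"
      using tendsto_add[OF tendsto_const[of t] LIMSEQ_inverse_real_of_nat]
      by (simp add: inverse_eq_divide add.commute)
    then show "(\<lambda>j. f (t + 1 / (real j + 1))) \<longlonglongrightarrow> f t"
      by (rule isCont_tendsto_compose[OF t])
  qed simp
  then have "(\<lambda>j. NE (indicat_real (U t) * b + ?w j - indicat_real (U t) * b)) \<longlonglongrightarrow> 0"
    using U_E w_E normed_space_onD(1)[OF V]
    by (intro kadets_klee_norm_convergent[OF V T H _ _ lim]) (simp_all add: f_def subspace_add)
  then have "eventually (\<lambda>j. NE (?w j) < \<epsilon>) sequentially"
    using order_tendstoD(2)[of _ 0 sequentially \<epsilon>] \<epsilon> by simp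
  then show ?thesis
    unfolding P_def by (auto simp: eventually_sequentially)
qed

text \<open>If no finite set left only small finite pieces of \<open>b\<close> outside it, finite pieces of
  large norm could be chosen one outside the other, against the smallness of disjoint pieces.\<close>

lemma pre_Lebesgue_kadets_klee_finite_pieces_small:
  fixes b :: "'g::countable \<Rightarrow> real"
  assumes E: "banach_sequence_space E NE" and L: "pre_Lebesgue E NE T" and H: "kadets_klee E NE T"
    and b: "b \<in> E" "\<And>\<gamma>. 0 \<le> b \<gamma>" and \<epsilon>: "0 < \<epsilon>"
  shows "\<exists>F. finite F \<and> (\<forall>G. finite G \<and> G \<inter> F = {} \<longrightarrow> NE (indicat_real G * b) < \<epsilon>)"
proof (rule ccontr)
  assume "\<not> ?thesis"
  then have "\<forall>F. finite F \<longrightarrow> (\<exists>G. finite G \<and> G \<inter> F = {} \<and> \<not> NE (indicat_real G * b) < \<epsilon>)"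
    by blast
  then obtain g where g: "\<And>F. finite F \<Longrightarrow> finite (g F)" "\<And>F. finite F \<Longrightarrow> g F \<inter> F = {}"
      "\<And>F. finite F \<Longrightarrow> \<not> NE (indicat_real (g F) * b) < \<epsilon>"
    by metis
  define A where "A n = ((\<lambda>F. F \<union> g F) ^^ n) {}" for n
  have A_Suc: "A (Suc n) = A n \<union> g (A n)" for n
    by (simp add: A_def)
  have fin: "finite (A n)" for n
    by (induction n) (use g(1) A_Suc in \<open>auto simp: A_def\<close>)
  have "mono A"
    using A_Suc by (intro mono_iff_le_Suc[THEN iffD2]) auto
  have less: "g (A m) \<inter> g (A n) = {}" if "m < n" for m n
  proof -
    have "g (A m) \<subseteq> A n"
      using monoD[OF \<open>mono A\<close>, of "Suc m" n] that A_Suc by auto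
    then show ?thesis
      using g(2)[OF fin[of n]] by blast
  qed
  have "disjoint_family (\<lambda>n. g (A n))"
    unfolding disjoint_family_on_def
  proof (intro ballI impI)
    fix m n :: nat
    assume "m \<noteq> n"
    then show "g (A m) \<inter> g (A n) = {}"
      using less[of m n] less[of n m] by (cases "m < n") auto
  qed
  then show False
    using pre_Lebesgue_kadets_klee_disjoint_small[OF E L H b _ \<epsilon>] g(3) fin by blast
qed

text \<open>Smallness of the finite pieces of \<open>b\<close> says that its finite sections form a Cauchy sequence.
  Completeness provides a limit, and this limit can only be \<open>b\<close>, since coordinates depend
  continuously on the vector. The detour through the limit is needed because the norm is not assumed to
  have the Fatou property: a priori an infinite tail may be larger than all its finite pieces.\<close>

lemma pre_Lebesgue_kadets_klee_tail_small:
  fixes b :: "'g::countable \<Rightarrow> real"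
  assumes E: "banach_sequence_space E NE" and L: "pre_Lebesgue E NE T" and H: "kadets_klee E NE T"
    and b: "b \<in> E" "\<And>\<gamma>. 0 \<le> b \<gamma>" and \<epsilon>: "0 < \<epsilon>"
  shows "\<exists>F. finite F \<and> NE (indicat_real (- F) * b) < \<epsilon>"
proof -
  note V = banach_sequence_spaceD(1)[OF E]
  interpret Metric_space E "norm_dist E NE"
    by (rule Metric_space_norm_dist[OF V])
  define A where "A n = {\<gamma>::'g. to_nat \<gamma> < n}" for n
  have fin: "finite (A n)" for n
    unfolding A_def using finite_vimageI[of "{..<n}" "to_nat :: 'g \<Rightarrow> nat"]
    by (simp add: vimage_def inj_on_def)
  define s where "s n = indicat_real (A n) * b" for n
  have s_E: "s n \<in> E" for n
    unfolding s_def by (rule restriction_in[OF E b(1)])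
  have "MCauchy s"
    unfolding MCauchy_def
  proof (intro conjI allI impI)
    show "range s \<subseteq> E"
      using s_E by blast
    fix \<delta> :: real
    assume "\<delta> > 0"
    from pre_Lebesgue_kadets_klee_finite_pieces_small[OF E L H b this] obtain F where
      F: "finite F" "\<And>G. finite G \<Longrightarrow> G \<inter> F = {} \<Longrightarrow> NE (indicat_real G * b) < \<delta>"
      by blast
    obtain k where k: "F \<subseteq> A k"
    proof
      show "F \<subseteq> A (Suc (Max (to_nat ` F)))"
        using F(1) by (auto simp: A_def less_Suc_eq_le)
    qed
    have *: "NE (s n - s m) < \<delta>" if "k \<le> m" "m \<le> n" for m n
    proof -
      have "s n - s m = indicat_real (A n - A m) * b"
        using that by (auto simp: s_def fun_eq_iff indicator_def A_def)
      moreover have "(A n - A m) \<inter> F = {}"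
        using k that by (auto simp: A_def)
      ultimately show ?thesis
        using F(2) fin by simp
    qed
    show "\<exists>k. \<forall>n m. k \<le> n \<longrightarrow> k \<le> m \<longrightarrow> norm_dist E NE (s n) (s m) < \<delta>"
    proof (intro exI[of _ k] allI impI)
      fix n m
      assume "k \<le> n" "k \<le> m"
      then show "norm_dist E NE (s n) (s m) < \<delta>"
        using *[of m n] *[of n m] norm_minus_commute_on[OF V s_E s_E, of n m] s_E
        by (cases "m \<le> n") (auto simp: norm_dist_def)
    qed
  qed
  then obtain c where c: "limitin mtopology s c sequentially"
    using banach_sequence_spaceD(2)[OF E] unfolding mcomplete_def by blast
  have c_E: "c \<in> E"
    using limitin_topspace[OF c] by simp
  have s_c: "(\<lambda>n. NE (s n - c)) \<longlonglongrightarrow> 0"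
    using c c_E s_E normed_space_onD(1,2)[OF V]
    by (auto simp: limit_metric_sequentially LIMSEQ_iff norm_dist_def subspace_diff)
  have "c \<gamma> = b \<gamma>" for \<gamma>
  proof (rule LIMSEQ_unique)
    show "(\<lambda>n. s n \<gamma>) \<longlonglongrightarrow> c \<gamma>"
      by (rule coordinate_tendsto[OF E s_E c_E s_c])
    show "(\<lambda>n. s n \<gamma>) \<longlonglongrightarrow> b \<gamma>"
      by (rule tendsto_eventually)
        (auto intro!: eventually_sequentiallyI[of "Suc (to_nat \<gamma>)"] simp: s_def A_def)
  qed
  then have "c = b"
    by blast
  with s_c obtain n where n: "NE (s n - b) < \<epsilon>"
    using order_tendstoD(2)[OF s_c \<epsilon>] by (auto simp: eventually_sequentially)
  have "NE (indicat_real (- A n) * b) \<le> NE (s n - b)"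
    using normed_space_onD(1)[OF V] s_E b
    by (intro banach_sequence_spaceD(5)[OF E]) (auto simp: subspace_diff s_def indicator_def)
  then show ?thesis
    using n fin[of n] by (blast intro: order_le_less_trans)
qed

section \<open>Norm convergence in direct sums\<close>

text \<open>Split the difference \<open>s n - x\<close> along a finite set \<open>F\<close>. The part in \<open>F\<close> is controlled
  coordinate by coordinate. Off \<open>F\<close> the norm of a coordinate of \<open>s n - x\<close> is at most twice that of \<open>x\<close>
  plus the difference of the two coordinate norms; the former is small if the tail of
  \<open>norm_fun N x\<close> off \<open>F\<close> is.\<close>

lemma direct_sum_norm_tendsto_0:
  fixes X :: "'g::countable \<Rightarrow> 'v::real_vector set"
  assumes X: "\<And>\<gamma>. normed_space_on (X \<gamma>) (N \<gamma>)" and E: "banach_sequence_space E NE"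
    and s: "\<And>n. s n \<in> direct_sum X N E" and x: "x \<in> direct_sum X N E"
    and tail: "\<And>\<epsilon>. 0 < \<epsilon> \<Longrightarrow> \<exists>F. finite F \<and> NE (indicat_real (- F) * norm_fun N x) < \<epsilon>"
    and norms: "(\<lambda>n. NE (norm_fun N (s n) - norm_fun N x)) \<longlonglongrightarrow> 0"
    and coords: "\<And>\<gamma>. (\<lambda>n. N \<gamma> (s n \<gamma> - x \<gamma>)) \<longlonglongrightarrow> 0"
  shows "(\<lambda>n. direct_sum_norm N NE (s n - x)) \<longlonglongrightarrow> 0"
proof (rule LIMSEQ_I)
  fix \<epsilon> :: real
  assume "0 < \<epsilon>"
  note V = banach_sequence_spaceD(1)[OF E]
  note sub = normed_space_onD(1)[OF V]
  note D = normed_space_on_direct_sum[OF X E]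
  obtain F where F: "finite F" "NE (indicat_real (- F) * norm_fun N x) < \<epsilon> / 4"
    using tail[of "\<epsilon> / 4"] \<open>0 < \<epsilon>\<close> by auto
  let ?x = "norm_fun N x" and ?s = "\<lambda>n. norm_fun N (s n)" and ?d = "\<lambda>n. norm_fun N (s n - x)"
  have x_E: "?x \<in> E" and s_E: "?s n \<in> E" for n
    using s x by (auto simp: direct_sum_def)
  have d_nonneg: "0 \<le> direct_sum_norm N NE (s n - x)" for n
    using normed_space_onD(1,2)[OF D] s x by (simp add: subspace_diff)
  define r where "r n = (\<Sum>\<gamma>\<in>F. \<bar>N \<gamma> (s n \<gamma> - x \<gamma>)\<bar> * NE (indicat_real {\<gamma>})) + NE (?s n - ?x)" for n
  have "r \<longlonglongrightarrow> (\<Sum>\<gamma>\<in>F. \<bar>0\<bar> * NE (indicat_real {\<gamma>})) + 0"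
    unfolding r_def by (intro tendsto_intros coords norms)
  then have "r \<longlonglongrightarrow> 0"
    by simp
  then have ev: "eventually (\<lambda>n. r n < \<epsilon> / 2) sequentially"
    using order_tendstoD(2)[of r 0 sequentially "\<epsilon> / 2"] \<open>0 < \<epsilon>\<close> by simp
  have bound: "direct_sum_norm N NE (s n - x) \<le> r n + 2 * NE (indicat_real (- F) * ?x)" for n
  proof -
    let ?p = "indicat_real F * ?d n" and ?q = "2 *\<^sub>R (indicat_real (- F) * ?x)"
      and ?e = "\<lambda>\<gamma>. \<bar>(?s n - ?x) \<gamma>\<bar>"
    have diff_E: "?s n - ?x \<in> E"
      using s_E x_E sub by (simp add: subspace_diff)
    have p: "?p \<in> E" "NE ?p \<le> (\<Sum>\<gamma>\<in>F. \<bar>N \<gamma> (s n \<gamma> - x \<gamma>)\<bar> * NE (indicat_real {\<gamma>}))"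
      using norm_finite_support_le[OF E F(1), of "?d n"] by (simp_all add: norm_fun_def)
    have q': "indicat_real (- F) * ?x \<in> E"
      by (rule restriction_in[OF E x_E])
    then have q: "?q \<in> E" "NE ?q = 2 * NE (indicat_real (- F) * ?x)"
      using sub normed_space_onD(4)[OF V q'] by (simp_all add: subspace_scale)
    have e: "?e \<in> E"
      by (rule banach_sequence_spaceD(4)[OF E diff_E]) simp
    have e': "NE ?e \<le> NE (?s n - ?x)"
      by (rule banach_sequence_spaceD(5)[OF E diff_E]) simp
    have "\<bar>?d n \<gamma>\<bar> \<le> \<bar>(?p + (?q + ?e)) \<gamma>\<bar>" for \<gamma>
    proof -
      have sx: "s n \<gamma> \<in> X \<gamma>" "x \<gamma> \<in> X \<gamma>" "- x \<gamma> \<in> X \<gamma>" "s n \<gamma> - x \<gamma> \<in> X \<gamma>"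
        using s[of n] x normed_space_onD(1)[OF X, of \<gamma>]
        by (auto simp: direct_sum_def subspace_diff subspace_neg)
      have "N \<gamma> (- x \<gamma>) = N \<gamma> (x \<gamma>)"
        using normed_space_onD(4)[OF X sx(2), of "-1"] by simp
      then have "N \<gamma> (s n \<gamma> - x \<gamma>) \<le> N \<gamma> (s n \<gamma>) + N \<gamma> (x \<gamma>)"
        using normed_space_onD(5)[OF X sx(1,3)] by simp
      moreover have "0 \<le> N \<gamma> (s n \<gamma> - x \<gamma>)" "0 \<le> N \<gamma> (x \<gamma>)"
        using normed_space_onD(2)[OF X] sx by blast+
      ultimately show ?thesis
        by (auto simp: norm_fun_def indicator_def scaleR_fun_def)
    qed
    then have "NE (?d n) \<le> NE (?p + (?q + ?e))"
      using p q e sub by (intro banach_sequence_spaceD(5)[OF E] subspace_add)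
    also have "\<dots> \<le> NE ?p + (NE ?q + NE ?e)"
      using normed_space_onD(5)[OF V p(1), of "?q + ?e"] normed_space_onD(5)[OF V q(1) e]
        q(1) e sub by (simp add: subspace_add)
    finally show ?thesis
      unfolding r_def direct_sum_norm_def using p q e' by linarith
  qed
  have "eventually (\<lambda>n. direct_sum_norm N NE (s n - x) < \<epsilon>) sequentially"
    using ev
  proof eventually_elim
    case (elim n)
    then show ?case
      using bound[of n] F(2) by linarith
  qed
  then show "\<exists>k. \<forall>n\<ge>k. norm (direct_sum_norm N NE (s n - x) - 0) < \<epsilon>"
    using d_nonneg by (auto simp: eventually_sequentially)
qed

section \<open>The Kadets--Klee property of direct sums\<close>

theorem theorem2:
  fixes X :: "'g::countable \<Rightarrow> 'v::real_vector set"
    and N :: "'g \<Rightarrow> 'v \<Rightarrow> real"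
    and TX :: "'g \<Rightarrow> 'v topology"
    and E :: "('g \<Rightarrow> real) set"
    and NE :: "('g \<Rightarrow> real) \<Rightarrow> real"
    and TE :: "('g \<Rightarrow> real) topology"
    and u :: "'g \<Rightarrow> 'v"
    and T :: "('g \<Rightarrow> 'v) topology"
  assumes X_banach: "\<And>\<gamma>. banach_space_on (X \<gamma>) (N \<gamma>)"
    and X_inf_dim: "\<And>\<gamma>. infinite_dimensional (X \<gamma>)"
    and X_top: "\<And>\<gamma>. coarser_linear_Hausdorff (X \<gamma>) (N \<gamma>) (TX \<gamma>)"
    and E_space: "banach_sequence_space E NE"
    and E_inf_dim: "infinite_dimensional E"
    and E_top: "coarser_linear_Hausdorff E NE TE"
    and u_unit: "\<And>\<gamma>. u \<gamma> \<in> unit_sphere_on (X \<gamma>) (N \<gamma>)"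
    and A1: "pre_Lebesgue E NE TE"
    and A2: "oplus_compatible X N TX E NE TE u T"
    and A3: "seq_continuous_map
      (subtopology T (unit_sphere_on (direct_sum X N E) (direct_sum_norm N NE))) TE (norm_fun N)"
    and H_X: "\<And>\<gamma>. kadets_klee (X \<gamma>) (N \<gamma>) (TX \<gamma>)"
    and H_E: "kadets_klee E NE TE"
  shows "kadets_klee (direct_sum X N E) (direct_sum_norm N NE) T"
  unfolding kadets_klee_def
proof (intro allI impI, elim conjE)
  let ?D = "direct_sum X N E" and ?ND = "direct_sum_norm N NE"
  fix s x
  assume s: "\<forall>n. s n \<in> unit_sphere_on ?D ?ND" and x: "x \<in> unit_sphere_on ?D ?ND"
    and lim: "limitin T s x sequentially"
  have X: "normed_space_on (X \<gamma>) (N \<gamma>)" for \<gamma>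
    using X_banach by (simp add: banach_space_on_def)
  note V = banach_sequence_spaceD(1)[OF E_space]
  have sD: "s n \<in> ?D" and xD: "x \<in> ?D" for n
    using s x by (auto simp: unit_sphere_on_def)
  have s_E: "norm_fun N (s n) \<in> E" and x_E: "norm_fun N x \<in> E" for n
    using sD xD by (auto simp: direct_sum_def)
  have topT: "topspace T = ?D"
    using A2 by (simp add: oplus_compatible_def coarser_linear_Hausdorff_def linear_topology_on_def)
  have "limitin (subtopology T (unit_sphere_on ?D ?ND)) s x sequentially"
    using lim s x by (simp add: limitin_subtopology)
  then have "limitin TE (\<lambda>n. norm_fun N (s n)) (norm_fun N x) sequentially"
    using s sD topT by (intro seq_continuous_mapD[OF A3]) simp_all
  moreover have "norm_fun N (s n) \<in> unit_sphere_on E NE" "norm_fun N x \<in> unit_sphere_on E NE" for n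
    using s x s_E x_E by (auto simp: unit_sphere_on_def direct_sum_norm_def)
  ultimately have norms: "(\<lambda>n. NE (norm_fun N (s n) - norm_fun N x)) \<longlonglongrightarrow> 0"
    using H_E[unfolded kadets_klee_def, rule_format, of "\<lambda>n. norm_fun N (s n)" "norm_fun N x"]
    by blast
  have coords: "(\<lambda>n. N \<gamma> (s n \<gamma> - x \<gamma>)) \<longlonglongrightarrow> 0" for \<gamma>
  proof (rule kadets_klee_norm_convergent[OF X _ H_X])
    show "linear_topology_on (X \<gamma>) (TX \<gamma>)"
      using X_top by (simp add: coarser_linear_Hausdorff_def)
    show "s n \<gamma> \<in> X \<gamma>" "x \<gamma> \<in> X \<gamma>" for n
      using sD xD by (auto simp: direct_sum_def)
    show "limitin (TX \<gamma>) (\<lambda>n. s n \<gamma>) (x \<gamma>) sequentially"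
      using A2 sD topT
      by (intro seq_continuous_mapD[of T "TX \<gamma>" "\<lambda>x. x \<gamma>", OF _ _ lim])
        (simp_all add: oplus_compatible_def)
    show "(\<lambda>n. N \<gamma> (s n \<gamma>)) \<longlonglongrightarrow> N \<gamma> (x \<gamma>)"
      using coordinate_tendsto[OF E_space s_E x_E norms, of \<gamma>] by (simp add: norm_fun_def)
  qed
  have "0 \<le> norm_fun N x \<gamma>" for \<gamma>
    using xD normed_space_onD(2)[OF X] by (simp add: direct_sum_def norm_fun_def)
  then have "\<exists>F. finite F \<and> NE (indicat_real (- F) * norm_fun N x) < \<epsilon>" if "0 < \<epsilon>" for \<epsilon>
    using pre_Lebesgue_kadets_klee_tail_small[OF E_space A1 H_E x_E _ that] by blast
  then show "(\<lambda>n. ?ND (s n - x)) \<longlonglongrightarrow> 0"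
    using direct_sum_norm_tendsto_0[OF X E_space sD xD _ norms coords] by blast
qed

end
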